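(* Let $N\ge3$ and $m=m_c:=\frac{N-2}{N}\in(0,1)$. Let $u(x,t)\ge0$ be the semigroup solution of the fast diffusion equation $\partial_t u=\Delta(u^m)$ in $\mathbb{R}^N\times(0,\infty)$ with initial data $u_0\in L^1(\mathbb{R}^N)$, $u_0\ge0$. Then for every $t>0$ the mass is conserved: $$\int_{\mathbb{R}^N}u(x,t)\,dx=\int_{\mathbb{R}^N}u_0(x)\,dx .$$
   Context: The semigroup solution is the mild solution $u\in C([0,\infty);L^1(\mathbb{R}^N))$ with $u(0)=u_0$ produced by the Crandall–Liggett theorem (limit of implicit time discretization) for the $m$-accretive operator $u\mapsto-\Delta(|u|^{m-1}u)$ in $L^1(\mathbb{R}^N)$. These solutions form a semigroup of $L^1$ contractions, and nonnegative data give nonnegative solutions. *)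

theory Defs
  imports "HOL-Analysis.Analysis"
begin

text \<open>
  The library has no Banach space \<open>L\<^sup>1\<close>; its elements are represented by Lebesgue integrable
  functions, equality being equality almost everywhere, and the norm is \<open>l1_norm\<close>.
\<close>

definition l1_norm :: "('a::euclidean_space \<Rightarrow> real) \<Rightarrow> real" where
  "l1_norm f = (LINT x|lebesgue. \<bar>f x\<bar>)"

definition l1_loc :: "('a::euclidean_space \<Rightarrow> real) \<Rightarrow> bool" where
  "l1_loc f \<longleftrightarrow> (\<forall>K. compact K \<longrightarrow> set_integrable lebesgue K f)"

definition partial_deriv :: "'a \<Rightarrow> ('a::euclidean_space \<Rightarrow> real) \<Rightarrow> 'a \<Rightarrow> real" where
  "partial_deriv b f x = frechet_derivative f (at x) b"

text \<open>
  A differentiable function is of class \<open>C\<^sup>k\<^sup>+\<^sup>1\<close> iff its partial derivatives are of class \<open>C\<^sup>k\<close>;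
  differentiability is required explicitly because \<^const>\<open>frechet_derivative\<close> is total.
\<close>

primrec C_k :: "nat \<Rightarrow> ('a::euclidean_space \<Rightarrow> real) \<Rightarrow> bool" where
  "C_k 0 f \<longleftrightarrow> continuous_on UNIV f"
| "C_k (Suc k) f \<longleftrightarrow> f differentiable_on UNIV \<and> (\<forall>b\<in>Basis. C_k k (partial_deriv b f))"

definition test_function :: "('a::euclidean_space \<Rightarrow> real) \<Rightarrow> bool" where
  "test_function \<phi> \<longleftrightarrow> (\<forall>k. C_k k \<phi>) \<and> compact (closure {x. \<phi> x \<noteq> 0})"

definition laplacian :: "('a::euclidean_space \<Rightarrow> real) \<Rightarrow> 'a \<Rightarrow> real" where
  "laplacian \<phi> x = (\<Sum>b\<in>Basis. partial_deriv b (partial_deriv b \<phi>) x)"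

definition has_distributional_laplacian ::
    "('a::euclidean_space \<Rightarrow> real) \<Rightarrow> ('a \<Rightarrow> real) \<Rightarrow> bool" where
  "has_distributional_laplacian w g \<longleftrightarrow> l1_loc w \<and> l1_loc g \<and>
     (\<forall>\<phi>. test_function \<phi> \<longrightarrow>
        (LINT x|lebesgue. w x * laplacian \<phi> x) = (LINT x|lebesgue. g x * \<phi> x))"

text \<open>
  The graph of \<open>u \<mapsto> - \<Delta>(|u|\<^sup>m\<^sup>-\<^sup>1 u)\<close> in \<open>L\<^sup>1\<close>, with its maximal domain: all \<open>u\<close> in \<open>L\<^sup>1\<close>
  whose distributional \<open>\<Delta>(|u|\<^sup>m\<^sup>-\<^sup>1 u)\<close> is again in \<open>L\<^sup>1\<close>.  No decay condition on
  \<open>|u|\<^sup>m\<^sup>-\<^sup>1 u\<close> is needed for this operator to be m-accretive in the critical case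
  \<open>m = (N - 2) / N\<close>, because there \<open>u \<in> L\<^sup>1\<close> gives \<open>|u|\<^sup>m\<^sup>-\<^sup>1 u \<in> L\<^sup>N\<^sup>/\<^sup>(\<^sup>N\<^sup>-\<^sup>2\<^sup>)\<close>, within the
  Benilan-Brezis-Crandall uniqueness class.  At \<open>u x = 0\<close> the expression below is 0.
\<close>

definition fde_operator ::
    "real \<Rightarrow> (('a::euclidean_space \<Rightarrow> real) \<times> ('a \<Rightarrow> real)) set" where
  "fde_operator m = {(u, v). integrable lebesgue u \<and> integrable lebesgue v \<and>
     has_distributional_laplacian (\<lambda>x. \<bar>u x\<bar> powr (m - 1) * u x) (\<lambda>x. - v x)}"

text \<open>
  \<open>n\<close> implicit Euler steps of size \<open>h\<close> for \<open>du/dt + A u = 0\<close>; up to null sets,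
  \<open>U k = (I + h A)\<^sup>-\<^sup>k f\<close> for all \<open>k \<le> n\<close>.
\<close>

definition implicit_euler ::
    "(('a::euclidean_space \<Rightarrow> real) \<times> ('a \<Rightarrow> real)) set \<Rightarrow> real \<Rightarrow> nat \<Rightarrow>
     ('a \<Rightarrow> real) \<Rightarrow> (nat \<Rightarrow> 'a \<Rightarrow> real) \<Rightarrow> bool" where
  "implicit_euler A h n f U \<longleftrightarrow>
     U 0 = f \<and> (\<forall>k<n. (U (Suc k), \<lambda>x. (U k x - U (Suc k) x) / h) \<in> A)"

definition l1_continuous :: "(real \<Rightarrow> 'a::euclidean_space \<Rightarrow> real) \<Rightarrow> bool" where
  "l1_continuous u \<longleftrightarrow> (\<forall>t\<ge>0. integrable lebesgue (u t) \<and>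
     ((\<lambda>s. l1_norm (\<lambda>x. u s x - u t x)) \<longlongrightarrow> 0) (at t within {0..}))"

text \<open>
  The mild solution given by the Crandall-Liggett exponential formula
  \<open>u(t) = lim (I + (t/n) A)\<^sup>-\<^sup>n u\<^sub>0\<close> (limit in \<open>L\<^sup>1\<close> as \<open>n\<close> tends to infinity).  The iterates are
  unique almost everywhere, so it does not matter which representatives \<open>U n\<close> are chosen.
\<close>

definition semigroup_solution ::
    "(('a::euclidean_space \<Rightarrow> real) \<times> ('a \<Rightarrow> real)) set \<Rightarrow>
     ('a \<Rightarrow> real) \<Rightarrow> (real \<Rightarrow> 'a \<Rightarrow> real) \<Rightarrow> bool" where
  "semigroup_solution A u\<^sub>0 u \<longleftrightarrow>
     l1_continuous u \<and> (AE x in lebesgue. u 0 x = u\<^sub>0 x) \<and>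
     (\<forall>t>0. \<exists>U. (\<forall>n>0. implicit_euler A (t / real n) n u\<^sub>0 (U n)) \<and>
        (\<lambda>n. l1_norm (\<lambda>x. U n n x - u t x)) \<longlonglongrightarrow> 0)"

end

theory Submission
  imports Defs "HOL-Real_Asymp.Real_Asymp"
begin

text \<open>
  Mass is conserved because every element \<open>v\<close> of the range of the operator has integral zero.
  If \<open>(u, v)\<close> is in the graph and \<open>w = |u|\<^sup>m\<^sup>-\<^sup>1 u\<close>, then testing \<open>\<Delta> w = - v\<close> with the rescaled
  bump \<open>\<phi>\<^sub>R(x) = \<phi>(x / R)\<close> gives \<open>\<integral> w \<Delta>\<phi>\<^sub>R = - \<integral> v \<phi>\<^sub>R\<close>.  As \<open>R\<close> tends to infinity the
  right-hand side tends to \<open>- \<phi>(0) \<integral> v\<close>.  The left-hand side is at most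
  \<open>C R\<^sup>-\<^sup>2 \<integral> |u|\<^sup>m\<close>, taken over the ball of radius \<open>R\<close>, and Hoelder's inequality bounds this by a
  multiple of \<open>R\<close> to the power \<open>N (1 - m) - 2\<close>.  For \<open>m = (N - 2) / N\<close> this exponent vanishes.

  Boundedness alone is not enough in the critical case; the limit has to be zero.  This comes from
  replacing Hoelder's inequality by its pointwise version \<open>critical_young\<close>, which splits
  \<open>R\<^sup>-\<^sup>2 |u|\<^sup>m\<close> into a constant \<open>\<delta>\<^sup>m R\<^sup>-\<^sup>N\<close>, whose integral over the ball is a multiple of \<open>\<delta>\<^sup>m\<close>
  whatever \<open>R\<close> is, and a term that is dominated by \<open>\<delta>\<^sup>m\<^sup>-\<^sup>1 |u|\<close> and tends to zero pointwise.
  Letting first \<open>R\<close> tend to infinity and then \<open>\<delta>\<close> to zero gives \<open>\<integral> v = 0\<close>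
  (\<open>fde_operator_integral_zero\<close>).

  An implicit Euler step subtracts a multiple of such a \<open>v\<close>, so all Euler iterates have the mass of
  the initial datum, and convergence in \<open>L\<^sup>1\<close> carries this over to the semigroup solution.
\<close>

section \<open>Functions of class C k\<close>

lemma partial_deriv_eqI:
  assumes "(f has_derivative f') (at x)"
  shows "partial_deriv b f x = f' b"
  using frechet_derivative_at[OF assms] by (simp add: partial_deriv_def)

lemma C_k_SucI:
  fixes f :: "'a::euclidean_space \<Rightarrow> real"
  assumes der: "\<And>x. (f has_derivative f' x) (at x)"
    and Ck: "\<And>b. b \<in> Basis \<Longrightarrow> C_k k (\<lambda>x. f' x b)"
  shows "C_k (Suc k) f"
proof -
  have "partial_deriv b f = (\<lambda>x. f' x b)" for b
    using partial_deriv_eqI[OF der] by blast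
  moreover have "f differentiable_on UNIV"
    using der by (auto simp: differentiable_on_def differentiable_def)
  ultimately show ?thesis
    using Ck by simp
qed

lemma C_k_SucD: "C_k (Suc k) f \<Longrightarrow> C_k k f"
proof (induction k arbitrary: f)
  case 0
  then show ?case by (simp add: differentiable_imp_continuous_on)
next
  case (Suc k)
  then show ?case by (simp del: C_k.simps(2) add: C_k.simps(2)[of "Suc k" f] C_k.simps(2)[of k f])
qed

lemma C_k_Suc_has_derivative:
  assumes "C_k (Suc k) f"
  shows "(f has_derivative (\<lambda>h. frechet_derivative f (at x) h)) (at x)"
  using assms by (auto simp: differentiable_on_def frechet_derivative_works[symmetric])

lemma C_k_const [simp]: "C_k k (\<lambda>x. c)"
proof (induction k arbitrary: c)
  case (Suc k)
  show ?case by (rule C_k_SucI[where f' = "\<lambda>x h. 0"]) (use Suc in auto)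
qed simp

lemma C_k_add: "C_k k f \<Longrightarrow> C_k k g \<Longrightarrow> C_k k (\<lambda>x. f x + g x)"
proof (induction k arbitrary: f g)
  case 0
  then show ?case by (simp add: continuous_on_add)
next
  case (Suc k)
  show ?case
    by (rule C_k_SucI[OF has_derivative_add[OF Suc.prems[THEN C_k_Suc_has_derivative]]])
      (use Suc in \<open>auto simp: partial_deriv_def[abs_def]\<close>)
qed

lemma C_k_mult: "C_k k f \<Longrightarrow> C_k k g \<Longrightarrow> C_k k (\<lambda>x. f x * g x)"
proof (induction k arbitrary: f g)
  case 0
  then show ?case by (simp add: continuous_on_mult)
next
  case (Suc k)
  show ?case
    by (rule C_k_SucI[OF has_derivative_mult[OF Suc.prems[THEN C_k_Suc_has_derivative]]])
      (use Suc Suc.prems[THEN C_k_SucD] in \<open>auto simp: partial_deriv_def[abs_def] intro!: C_k_add\<close>)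
qed

lemma C_k_inner_left: "C_k k (\<lambda>x. x \<bullet> b)"
proof (cases k)
  case (Suc j)
  show ?thesis unfolding Suc
    by (rule C_k_SucI[where f' = "\<lambda>x h. h \<bullet> b"]) (auto intro!: derivative_eq_intros)
qed (simp add: continuous_on_inner)

section \<open>A bump function\<close>

text \<open>
  \<open>flat 0\<close> is the classical smooth function that vanishes to infinite order at 0.  The functions
  \<open>flat j\<close> span a space closed under differentiation (\<open>DERIV_flat\<close>), so one induction over all \<open>j\<close>
  at once yields smoothness.  The bump is then \<open>flat 0 (1 - |x|\<^sup>2 / R\<^sup>2)\<close>; taking \<open>|x|\<^sup>2\<close> as the argument
  avoids the singularity of the norm at the origin.
\<close>

definition flat :: "nat \<Rightarrow> real \<Rightarrow> real" where
  "flat j s = (if s > 0 then exp (- 1 / s) / s ^ j else 0)"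

lemma flat_tendsto_0: "(flat j \<longlongrightarrow> 0) (at 0)"
proof -
  have "((\<lambda>s. exp (- 1 / s) / s ^ j) \<longlongrightarrow> 0) (at_right (0::real))"
    by real_asymp
  then have "(flat j \<longlongrightarrow> 0) (at_right 0)"
    by (rule Lim_transform_eventually)
      (auto simp: flat_def eventually_at_right_less intro: eventually_mono[OF eventually_at_right_less])
  moreover have "(flat j \<longlongrightarrow> 0) (at_left 0)"
    by (rule Lim_transform_eventually[OF tendsto_const])
      (auto simp: flat_def eventually_at_left_field intro: exI[of _ "-1"])
  ultimately show ?thesis
    by (simp add: filterlim_split_at)
qed

lemma DERIV_flat:
  "(flat j has_real_derivative (flat (j + 2) s - real j * flat (j + 1) s)) (at s)"
proof -
  consider "s > 0" | "s < 0" | "s = 0" by linarith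
  then show ?thesis
  proof cases
    case 1
    have "((\<lambda>s. exp (- inverse s) * inverse s ^ j) has_real_derivative
        exp (- inverse s) * inverse s ^ (j + 2) - real j * (exp (- inverse s) * inverse s ^ (j + 1))) (at s)"
      \<comment> \<open>The power rule produces exponents with truncated subtraction; small \<open>j\<close> are separate cases.\<close>
      using 1 by (cases j; cases "j - 1";
          fastforce intro!: derivative_eq_intros simp: algebra_simps power2_eq_square)
    then have "((\<lambda>s. exp (- 1 / s) / s ^ j) has_real_derivative
        (flat (j + 2) s - real j * flat (j + 1) s)) (at s)"
      using 1 by (simp add: flat_def divide_inverse power_inverse)
    then show ?thesis
      by (rule has_field_derivative_transform_within_open[of _ _ _ "{0<..}"])
        (use 1 in \<open>auto simp: flat_def\<close>)
  next
    case 2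
    have "((\<lambda>s. 0) has_real_derivative 0) (at s)" by simp
    then have "(flat j has_real_derivative 0) (at s)"
      by (rule has_field_derivative_transform_within_open[of _ _ _ "{..<0}"])
        (use 2 in \<open>auto simp: flat_def\<close>)
    then show ?thesis using 2 by (simp add: flat_def)
  next
    case 3
    \<comment> \<open>The difference quotient at 0 is itself a member of the family, and it tends to 0.\<close>
    have "(flat j y - flat j 0) / (y - 0) = flat (Suc j) y" for y
      by (auto simp: flat_def field_simps)
    then have "(flat j has_real_derivative 0) (at 0)"
      using flat_tendsto_0[of "Suc j"] by (simp add: has_field_derivative_iff)
    then show ?thesis using 3 by (simp add: flat_def)
  qed
qed

lemma isCont_flat: "isCont (flat j) s"
  using DERIV_flat DERIV_isCont by blast

lemma flat_bounded: "\<exists>B\<ge>0. \<forall>s\<le>1. \<bar>flat j s\<bar> \<le> B"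
proof -
  have "compact (flat j ` {0..1})"
    by (intro compact_continuous_image compact_Icc continuous_at_imp_continuous_on)
      (simp add: isCont_flat)
  then obtain B where B: "\<And>s. s \<in> {0..1} \<Longrightarrow> \<bar>flat j s\<bar> \<le> B"
    by (fastforce dest!: compact_imp_bounded simp: bounded_iff)
  from B[of 0] have "B \<ge> 0" by simp
  moreover have "\<bar>flat j s\<bar> \<le> B" if "s \<le> 1" for s
    using that B[of s] \<open>B \<ge> 0\<close> by (cases "s \<ge> 0") (auto simp: flat_def)
  ultimately show ?thesis by blast
qed

lemma has_derivative_flat_radial:
  "((\<lambda>x. flat j (1 - a * (x \<bullet> x))) has_derivative
    (\<lambda>h. (flat (j + 2) (1 - a * (x \<bullet> x)) + - real j * flat (j + 1) (1 - a * (x \<bullet> x))) *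
         ((- 2 * a) * (x \<bullet> h)))) (at x)"
proof -
  have "((\<lambda>x. 1 - a * (x \<bullet> x)) has_derivative (\<lambda>h. (- 2 * a) * (x \<bullet> h))) (at x)"
    by (auto intro!: derivative_eq_intros simp: inner_commute algebra_simps)
  from has_derivative_compose[OF this DERIV_flat[unfolded has_field_derivative_def]]
  show ?thesis by (simp add: algebra_simps)
qed

lemma C_k_flat_radial: "C_k k (\<lambda>x. flat j (1 - a * (x \<bullet> x)))"
proof (induction k arbitrary: j)
  case 0
  show ?case
    by (auto intro!: continuous_at_imp_continuous_on has_derivative_continuous
        has_derivative_flat_radial)
next
  case (Suc k)
  show ?case
    by (rule C_k_SucI[OF has_derivative_flat_radial])
      (intro C_k_mult C_k_add C_k_const C_k_inner_left Suc)
qed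

section \<open>Rescaled cutoff functions\<close>

lemma partial_deriv_bump:
  "partial_deriv b (\<lambda>x. flat 0 (1 - a * (x \<bullet> x))) = (\<lambda>x. flat 2 (1 - a * (x \<bullet> x)) * ((- 2 * a) * (x \<bullet> b)))"
  by (rule ext, rule trans[OF partial_deriv_eqI[OF has_derivative_flat_radial]])
    (simp add: numeral_2_eq_2)

lemma partial_deriv2_bump:
  assumes "b \<in> Basis"
  shows "partial_deriv b (partial_deriv b (\<lambda>x. flat 0 (1 - a * (x \<bullet> x)))) x =
    (- 2 * a) * flat 2 (1 - a * (x \<bullet> x)) +
    4 * a\<^sup>2 * (flat 4 (1 - a * (x \<bullet> x)) - 2 * flat 3 (1 - a * (x \<bullet> x))) * (x \<bullet> b)\<^sup>2"
proof -
  have "((\<lambda>x. (- 2 * a) * (x \<bullet> b)) has_derivative (\<lambda>h. (- 2 * a) * (h \<bullet> b))) (at x)"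
    by (auto intro!: derivative_eq_intros)
  from partial_deriv_eqI[OF has_derivative_mult[OF has_derivative_flat_radial[of 2 a] this], of b]
  show ?thesis
    unfolding partial_deriv_bump
    by (rule trans) (use assms in \<open>simp add: algebra_simps power2_eq_square eval_nat_numeral\<close>)
qed

lemma laplacian_bump:
  fixes x :: "'a::euclidean_space"
  shows "laplacian (\<lambda>x. flat 0 (1 - a * (x \<bullet> x))) x =
    a * (- 2 * real DIM('a) * flat 2 (1 - a * (x \<bullet> x)) +
      4 * (a * (x \<bullet> x)) * (flat 4 (1 - a * (x \<bullet> x)) - 2 * flat 3 (1 - a * (x \<bullet> x))))"
proof -
  let ?F = "\<lambda>j. flat j (1 - a * (x \<bullet> x))"
  have "laplacian (\<lambda>x. flat 0 (1 - a * (x \<bullet> x))) x =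
      (\<Sum>b\<in>Basis. (- 2 * a) * ?F 2 + 4 * a\<^sup>2 * (?F 4 - 2 * ?F 3) * (x \<bullet> b)\<^sup>2)"
    unfolding laplacian_def by (intro sum.cong refl partial_deriv2_bump)
  also have "\<dots> = DIM('a) * ((- 2 * a) * ?F 2) +
      4 * a\<^sup>2 * (?F 4 - 2 * ?F 3) * (\<Sum>b\<in>Basis. (x \<bullet> b)\<^sup>2)"
    by (simp only: sum.distrib sum_constant sum_distrib_left)
  also have "(\<Sum>b\<in>Basis. (x \<bullet> b)\<^sup>2) = x \<bullet> x"
    by (simp add: euclidean_inner[of x x] power2_eq_square)
  finally show ?thesis
    by (simp add: algebra_simps power2_eq_square)
qed

lemma test_function_bump:
  fixes R :: real
  assumes "R > 0"
  shows "test_function (\<lambda>x::'a::euclidean_space. flat 0 (1 - (1 / R\<^sup>2) * (x \<bullet> x)))"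
proof -
  have "{x::'a. flat 0 (1 - (1 / R\<^sup>2) * (x \<bullet> x)) \<noteq> 0} \<subseteq> cball 0 R"
  proof clarify
    fix x :: 'a
    assume "flat 0 (1 - (1 / R\<^sup>2) * (x \<bullet> x)) \<noteq> 0"
    then have "1 - (1 / R\<^sup>2) * (x \<bullet> x) > 0"
      by (metis flat_def)
    then have "(norm x)\<^sup>2 < R\<^sup>2"
      using assms by (simp add: dot_square_norm field_simps)
    then show "x \<in> cball 0 R"
      using assms by (simp add: power2_less_imp_less less_imp_le)
  qed
  then have "bounded {x::'a. flat 0 (1 - (1 / R\<^sup>2) * (x \<bullet> x)) \<noteq> 0}"
    using bounded_cball bounded_subset by blast
  then show ?thesis
    unfolding test_function_def by (simp only: C_k_flat_radial compact_closure simp_thms)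
qed

text \<open>
  The constant does not depend on \<open>R\<close>: in \<open>laplacian_bump\<close> with \<open>a = 1 / R\<^sup>2\<close> one factor \<open>a\<close> is
  explicit, and the other one occurs only in \<open>a |x|\<^sup>2\<close>, which is at most 1 on the support.
\<close>

lemma laplacian_bump_bound:
  obtains C where "C \<ge> 0"
    "\<And>R (x::'a::euclidean_space). R > 0 \<Longrightarrow>
      \<bar>laplacian (\<lambda>x. flat 0 (1 - (1 / R\<^sup>2) * (x \<bullet> x))) x\<bar> \<le> C * (1 / R\<^sup>2) * indicator (cball 0 R) x"
proof -
  obtain B where B: "\<And>j. B j \<ge> 0" "\<And>j s. s \<le> 1 \<Longrightarrow> \<bar>flat j s\<bar> \<le> B j"
    using flat_bounded by metis
  define C where "C = 2 * DIM('a) * B 2 + 4 * (B 4 + 2 * B 3)"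
  have "C \<ge> 0" using B(1) by (simp add: C_def)
  moreover have "\<bar>laplacian (\<lambda>x. flat 0 (1 - (1 / R\<^sup>2) * (x \<bullet> x))) x\<bar> \<le> C * (1 / R\<^sup>2) * indicator (cball 0 R) x"
    if "R > 0" for R and x :: 'a
  proof (cases "x \<in> cball 0 R")
    case False
    then have "R\<^sup>2 < x \<bullet> x"
      using that by (simp add: dot_square_norm power_strict_mono)
    then have "\<not> 0 < 1 - 1 / R\<^sup>2 * (x \<bullet> x)"
      using that by (simp add: field_simps)
    then have "flat j (1 - 1 / R\<^sup>2 * (x \<bullet> x)) = 0" for j
      by (simp only: flat_def if_False)
    then show ?thesis
      using False by (simp only: laplacian_bump) simp
  next
    case True
    define p where "p = 1 / R\<^sup>2 * (x \<bullet> x)"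
    have "x \<bullet> x \<le> R\<^sup>2"
      using True by (simp add: dot_square_norm power_mono)
    then have p: "0 \<le> p" "p \<le> 1"
      using that by (auto simp: p_def field_simps)
    have "\<bar>- 2 * real DIM('a) * flat 2 (1 - p)\<bar> \<le> 2 * DIM('a) * B 2"
      using B(2)[of "1 - p" 2] p by (simp add: abs_mult)
    moreover have "\<bar>flat 4 (1 - p) - 2 * flat 3 (1 - p)\<bar> \<le> B 4 + 2 * B 3"
      using B(2)[of "1 - p" 4] B(2)[of "1 - p" 3] p by simp
    then have "\<bar>4 * p * (flat 4 (1 - p) - 2 * flat 3 (1 - p))\<bar> \<le> 4 * (1 * (B 4 + 2 * B 3))"
      unfolding abs_mult mult.assoc using p by (intro mult_left_mono mult_mono) auto
    ultimately have "\<bar>- 2 * real DIM('a) * flat 2 (1 - p) + 4 * p * (flat 4 (1 - p) - 2 * flat 3 (1 - p))\<bar> \<le> C"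
      unfolding C_def by linarith
    then have "1 / R\<^sup>2 * \<bar>- 2 * real DIM('a) * flat 2 (1 - p) + 4 * p * (flat 4 (1 - p) - 2 * flat 3 (1 - p))\<bar> \<le> 1 / R\<^sup>2 * C"
      by (intro mult_left_mono) auto
    then show ?thesis
      unfolding laplacian_bump p_def[symmetric] using True by (simp add: abs_mult mult.commute)
  qed
  ultimately show thesis by (rule that)
qed

section \<open>Critical interpolation\<close>

text \<open>
  Which summand on the right is used depends on the threshold \<open>t = \<delta> R\<^sup>-\<^sup>N\<close>: below it,
  \<open>s\<^sup>m\<close> is at most \<open>t\<^sup>m\<close>; above it, \<open>s\<^sup>m\<^sup>-\<^sup>1\<close> is at most \<open>t\<^sup>m\<^sup>-\<^sup>1\<close>, since \<open>m < 1\<close>.  The powers of \<open>R\<close>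
  match because \<open>N (1 - m) = 2\<close>.  The minimum keeps both properties needed of the second
  summand: for fixed \<open>s\<close> it tends to 0 as \<open>R\<close> grows, and it is at most \<open>\<delta>\<^sup>m\<^sup>-\<^sup>1 s\<close>.
\<close>

lemma critical_young:
  fixes N m \<delta> R s :: real
  assumes "N > 2" "m = (N - 2) / N" "\<delta> > 0" "R > 0" "s \<ge> 0"
  shows "1 / R\<^sup>2 * s powr m \<le> \<delta> powr m * R powr (- N) + min (1 / R\<^sup>2 * s powr m) (\<delta> powr (m - 1) * s)"
proof -
  define t where "t = \<delta> * R powr (- N)"
  have "t > 0" using assms by (simp add: t_def)
  have Nm: "N * m = N - 2" "m > 0" "m < 1"
    using assms by auto
  have exponent: "- (N * (m - 1)) = 2"
    using Nm(1) by (simp add: algebra_simps)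
  have R2: "1 / R\<^sup>2 = R powr (-2)"
    using assms by (simp add: powr_minus_divide)
  have nn: "0 \<le> min (1 / R\<^sup>2 * s powr m) (\<delta> powr (m - 1) * s)"
    using assms by simp
  show ?thesis
  proof (cases "s \<le> t")
    case True
    have "1 / R\<^sup>2 * s powr m \<le> R powr (-2) * t powr m"
      unfolding R2 using True assms Nm by (intro mult_left_mono powr_mono2) auto
    also have "\<dots> = \<delta> powr m * R powr (- N)"
      using assms Nm by (simp add: t_def powr_mult powr_powr flip: powr_add) 
    finally show ?thesis using nn by linarith
  next
    case False
    then have "s powr (m - 1) \<le> t powr (m - 1)"
      using \<open>t > 0\<close> Nm by (intro powr_mono2') auto
    moreover have "s powr m = s powr (m - 1) * s"
      using False \<open>t > 0\<close> by (simp add: powr_diff)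
    ultimately have "1 / R\<^sup>2 * s powr m \<le> R powr (-2) * (t powr (m - 1) * s)"
      unfolding R2 using assms by (intro mult_left_mono) (auto intro: mult_right_mono)
    also have "\<dots> = \<delta> powr (m - 1) * s"
      using assms(3,4) by (simp add: t_def powr_mult powr_powr exponent R2[symmetric])
    finally have "min (1 / R\<^sup>2 * s powr m) (\<delta> powr (m - 1) * s) = 1 / R\<^sup>2 * s powr m"
      by simp
    then show ?thesis by simp
  qed
qed

text \<open>
  Formally \<open>v\<close> is a divergence and the flux at infinity vanishes.  In dimension at most 2 the
  exponent \<open>m\<close> would not be positive, and letting \<open>\<delta>\<close> tend to 0 would not remove the error
  \<open>\<delta>\<^sup>m\<close>.
\<close>

lemma fde_operator_integral_zero:
  fixes u v :: "'a::euclidean_space \<Rightarrow> real"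
  assumes dim: "DIM('a) \<ge> 3"
    and m: "m = (real DIM('a) - 2) / real DIM('a)"
    and uv: "(u, v) \<in> fde_operator m"
  shows "(LINT x|lebesgue. v x) = 0"
proof -
  define w where "w = (\<lambda>x. \<bar>u x\<bar> powr (m - 1) * u x)"
  define N where "N = real DIM('a)"
  define R where "R n = real (Suc n)" for n
  define \<phi> where "\<phi> n = (\<lambda>x::'a. flat 0 (1 - (1 / (R n)\<^sup>2) * (x \<bullet> x)))" for n
  have N: "N > 2" and mN: "m = (N - 2) / N"
    using dim m by (auto simp: N_def)
  have m01: "m > 0" "m < 1"
    using N mN by auto
  have R: "R n > 0" for n by (simp add: R_def)
  have u: "integrable lebesgue u" and v: "integrable lebesgue v"
    and dist: "test_function \<psi> \<Longrightarrow>
      (LINT x|lebesgue. w x * laplacian \<psi> x) = (LINT x|lebesgue. - v x * \<psi> x)" for \<psi>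
    using uv by (auto simp: fde_operator_def has_distributional_laplacian_def w_def)
  have [measurable]: "u \<in> borel_measurable lebesgue" "v \<in> borel_measurable lebesgue"
    using u v by auto
  have abs_w: "\<bar>w x\<bar> = \<bar>u x\<bar> powr m" for x
    by (simp add: w_def abs_mult powr_diff)
  obtain C where C: "C \<ge> 0" "\<And>r (x::'a). r > 0 \<Longrightarrow>
      \<bar>laplacian (\<lambda>x. flat 0 (1 - (1 / r\<^sup>2) * (x \<bullet> x))) x\<bar> \<le> C * (1 / r\<^sup>2) * indicator (cball 0 r) x"
    using laplacian_bump_bound by blast
  define K where "K = unit_ball_vol N"
  have lim_v: "(\<lambda>n. LINT x|lebesgue. v x * \<phi> n x) \<longlonglongrightarrow> (LINT x|lebesgue. v x * flat 0 1)"
  proof (rule integral_dominated_convergence[where w = "\<lambda>x. \<bar>v x\<bar>"])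
    show "integrable lebesgue (\<lambda>x. \<bar>v x\<bar>)" using v by simp
    show "AE x in lebesgue. (\<lambda>n. v x * \<phi> n x) \<longlonglongrightarrow> v x * flat 0 1"
    proof (rule AE_I2)
      fix x :: 'a
      have "(\<lambda>n. 1 - (1 / (R n)\<^sup>2) * (x \<bullet> x)) \<longlonglongrightarrow> 1"
        unfolding R_def by real_asymp
      from isCont_tendsto_compose[OF isCont_flat this, of 0]
      show "(\<lambda>n. v x * \<phi> n x) \<longlonglongrightarrow> v x * flat 0 1"
        unfolding \<phi>_def by (intro tendsto_mult tendsto_const)
    qed
    show "AE x in lebesgue. norm (v x * \<phi> n x) \<le> \<bar>v x\<bar>" for n
    proof (rule AE_I2)
      fix x :: 'a
      have "\<bar>\<phi> n x\<bar> \<le> 1" by (simp add: \<phi>_def flat_def)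
      then show "norm (v x * \<phi> n x) \<le> \<bar>v x\<bar>"
        by (simp add: abs_mult mult_left_le)
    qed
    have "continuous_on UNIV (\<phi> n)" for n
      using C_k_flat_radial[of 0 0 "1 / (R n)\<^sup>2"] by (simp add: \<phi>_def)
    then have "\<phi> n \<in> borel_measurable borel" for n
      by (rule borel_measurable_continuous_onI)
    then have [measurable]: "\<phi> n \<in> borel_measurable lebesgue" for n
      by (simp add: measurable_completion)
    show "(\<lambda>x. v x * \<phi> n x) \<in> borel_measurable lebesgue" for n
      by measurable
  qed simp
  \<comment> \<open>The limit \<open>n \<rightarrow> \<infinity>\<close> is taken here for fixed \<open>\<delta>\<close>; only the \<open>R\<close>-independent error remains.\<close>
  have key: "\<bar>LINT x|lebesgue. v x * flat 0 1\<bar> \<le> C * K * \<delta> powr m" if \<delta>: "\<delta> > 0" for \<delta>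
  proof -
    \<comment> \<open>The part of \<open>R\<^sup>-\<^sup>2 |u|\<^sup>m\<close> that dominated convergence controls.\<close>
    define g where "g n x = min (1 / (R n)\<^sup>2 * \<bar>u x\<bar> powr m) (\<delta> powr (m - 1) * \<bar>u x\<bar>)" for n x
    have g_le: "norm (g n x) \<le> \<delta> powr (m - 1) * \<bar>u x\<bar>" for n x
      by (simp add: g_def)
    have g_meas [measurable]: "g n \<in> borel_measurable lebesgue" for n
      unfolding g_def by measurable
    have dom: "integrable lebesgue (\<lambda>x. \<delta> powr (m - 1) * \<bar>u x\<bar>)"
      using u by simp
    have g_int: "integrable lebesgue (g n)" for n
      by (rule Bochner_Integration.integrable_bound[OF dom g_meas]) (use g_le in auto)
    have lim_g: "(\<lambda>n. LINT x|lebesgue. g n x) \<longlonglongrightarrow> (LINT x::'a|lebesgue. 0)"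
    proof (rule integral_dominated_convergence[OF _ g_meas dom])
      show "AE x in lebesgue. (\<lambda>n. g n x) \<longlonglongrightarrow> 0"
      proof (rule AE_I2)
        fix x :: 'a
        have "(\<lambda>n. 1 / (R n)\<^sup>2 * \<bar>u x\<bar> powr m) \<longlonglongrightarrow> 0"
          unfolding R_def by real_asymp
        from tendsto_min[OF this tendsto_const[of "\<delta> powr (m - 1) * \<bar>u x\<bar>"]]
        show "(\<lambda>n. g n x) \<longlonglongrightarrow> 0"
          by (simp add: g_def)
      qed
    qed (use g_le in auto)
    have "\<bar>LINT x|lebesgue. v x * \<phi> n x\<bar> \<le> C * K * \<delta> powr m + C * (LINT x|lebesgue. g n x)" for n
    proof -
      let ?b = "\<lambda>x. C * (\<delta> powr m * R n powr (- N)) * indicator (cball 0 (R n)) x + C * g n x"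
      have ind: "integrable lebesgue (indicator (cball (0::'a) (R n)) :: 'a \<Rightarrow> real)"
        by (intro integrable_real_indicator) (use emeasure_lborel_cball_finite[of 0 "R n"] in \<open>auto simp: top.not_eq_extremum\<close>)
      have "\<bar>LINT x|lebesgue. v x * \<phi> n x\<bar> = \<bar>LINT x|lebesgue. w x * laplacian (\<phi> n) x\<bar>"
        using dist[OF test_function_bump[OF R[of n]]] by (simp add: \<phi>_def)
      also have "\<dots> \<le> (LINT x|lebesgue. \<bar>w x * laplacian (\<phi> n) x\<bar>)"
        using integral_norm_bound[of lebesgue "\<lambda>x. w x * laplacian (\<phi> n) x"] by simp
      also have "\<dots> \<le> (LINT x|lebesgue. ?b x)"
      proof (rule integral_mono')
        show "integrable lebesgue ?b"
          using ind g_int by (intro Bochner_Integration.integrable_add integrable_mult_right)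
      next
        fix x :: 'a
        show "0 \<le> ?b x" using C by (simp add: g_def)
        have "\<bar>w x * laplacian (\<phi> n) x\<bar> \<le> \<bar>u x\<bar> powr m * (C * (1 / (R n)\<^sup>2) * indicator (cball 0 (R n)) x)"
          unfolding abs_mult abs_w \<phi>_def by (intro mult_left_mono C(2) R) auto
        also have "\<dots> = C * (1 / (R n)\<^sup>2 * \<bar>u x\<bar> powr m) * indicator (cball 0 (R n)) x"
          by simp
        also have "\<dots> \<le> C * (\<delta> powr m * R n powr (- N) + g n x) * indicator (cball 0 (R n)) x"
          unfolding g_def using C(1)
          by (intro mult_right_mono mult_left_mono critical_young[OF N mN \<delta> R]) auto
        also have "\<dots> \<le> ?b x"
          using C(1) by (auto simp: indicator_def algebra_simps g_def)
        finally show "\<bar>w x * laplacian (\<phi> n) x\<bar> \<le> ?b x" .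
      qed
      also have "\<dots> = C * (\<delta> powr m * R n powr (- N)) * measure lebesgue (cball (0::'a) (R n)) + C * (LINT x|lebesgue. g n x)"
        using ind g_int by simp
      also have "measure lebesgue (cball (0::'a) (R n)) = K * R n powr N"
        using content_cball[of "R n" "0::'a"] R[of n] by (simp add: K_def N_def powr_realpow)
      also have "C * (\<delta> powr m * R n powr (- N)) * (K * R n powr N) = C * K * \<delta> powr m"
        using R[of n] by (simp add: powr_minus field_simps)
      finally show ?thesis .
    qed
    moreover have "(\<lambda>n. C * K * \<delta> powr m + C * (LINT x|lebesgue. g n x)) \<longlonglongrightarrow> C * K * \<delta> powr m + C * 0"
      using lim_g by (intro tendsto_intros) simp
    ultimately show ?thesis
      using LIMSEQ_le[OF tendsto_rabs[OF lim_v]] by auto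
  qed
  have "((\<lambda>\<delta>. C * K * \<delta> powr m) \<longlongrightarrow> 0) (at_right 0)"
    using m01 by real_asymp
  then have "\<bar>LINT x|lebesgue. v x * flat 0 1\<bar> \<le> 0"
  proof (rule tendsto_lowerbound)
    show "\<forall>\<^sub>F \<delta> in at_right 0. \<bar>LINT x|lebesgue. v x * flat 0 1\<bar> \<le> C * K * \<delta> powr m"
      by (rule eventually_mono[OF eventually_at_right_less key])
  qed simp
  then show ?thesis
    by (simp add: flat_def)
qed

section \<open>Conservation of mass\<close>

lemma implicit_euler_integral:
  assumes zero: "\<And>u v. (u, v) \<in> A \<Longrightarrow> integrable lebesgue u \<and> (LINT x|lebesgue. v x) = 0"
    and f: "integrable lebesgue f" and h: "h \<noteq> 0" and U: "implicit_euler A h n f U" and k: "k \<le> n"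
  shows "integrable lebesgue (U k) \<and> (LINT x|lebesgue. U k x) = (LINT x|lebesgue. f x)"
  using k
proof (induction k)
  case 0
  then show ?case using U f by (simp add: implicit_euler_def)
next
  case (Suc k)
  have "(U (Suc k), \<lambda>x. (U k x - U (Suc k) x) / h) \<in> A"
    using U Suc.prems by (simp add: implicit_euler_def)
  from zero[OF this] Suc h show ?case
    using Bochner_Integration.integral_diff[of lebesgue "U k" "U (Suc k)"] by simp
qed

theorem theorem7p1:
  fixes m :: real
    and u\<^sub>0 :: "real ^ 'n \<Rightarrow> real"
    and u :: "real \<Rightarrow> real ^ 'n \<Rightarrow> real"
  assumes "CARD('n) \<ge> 3"
    and "m = (real CARD('n) - 2) / real CARD('n)"
    and "integrable lebesgue u\<^sub>0"
    and "AE x in lebesgue. u\<^sub>0 x \<ge> 0"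
    and "semigroup_solution (fde_operator m) u\<^sub>0 u"
    and "\<forall>t>0. AE x in lebesgue. u t x \<ge> 0"
  shows "\<forall>t>0. (LINT x|lebesgue. u t x) = (LINT x|lebesgue. u\<^sub>0 x)"
proof (intro allI impI)
  fix t :: real
  assume t: "t > 0"
  let ?M = "LINT x|lebesgue. u\<^sub>0 x"
  obtain U where U: "\<forall>n>0. implicit_euler (fde_operator m) (t / real n) n u\<^sub>0 (U n)"
    and lim: "(\<lambda>n. l1_norm (\<lambda>x. U n n x - u t x)) \<longlonglongrightarrow> 0"
    using assms(5) t unfolding semigroup_solution_def by blast
  have ut: "integrable lebesgue (u t)"
    using assms(5) t by (simp add: semigroup_solution_def l1_continuous_def)
  have zero: "integrable lebesgue w \<and> (LINT x|lebesgue. v x) = 0"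
    if "(w, v) \<in> fde_operator m" for w v :: "real ^ 'n \<Rightarrow> real"
  proof
    show "integrable lebesgue w"
      using that by (simp add: fde_operator_def)
    show "(LINT x|lebesgue. v x) = 0"
      by (rule fde_operator_integral_zero[OF _ _ that]) (simp_all add: assms(1,2))
  qed
  have "\<bar>?M - (LINT x|lebesgue. u t x)\<bar> \<le> l1_norm (\<lambda>x. U n n x - u t x)" if n: "n > 0" for n
  proof -
    have Un: "integrable lebesgue (U n n)" "(LINT x|lebesgue. U n n x) = ?M"
      using implicit_euler_integral[OF zero assms(3) _ U[rule_format, OF n], of n] t n by auto
    have "?M - (LINT x|lebesgue. u t x) = (LINT x|lebesgue. U n n x - u t x)"
      using Un ut by simp
    then show ?thesis
      using integral_norm_bound[of lebesgue "\<lambda>x. U n n x - u t x"] by (simp add: l1_norm_def)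
  qed
  then have "\<bar>?M - (LINT x|lebesgue. u t x)\<bar> \<le> 0"
    by (intro tendsto_lowerbound[OF lim] eventually_mono[OF eventually_gt_at_top[of 0]]) auto
  then show "(LINT x|lebesgue. u t x) = ?M"
    by simp
qed

end
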